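(* There is an algorithm that, given a DFA $M$ with $n$ states over an alphabet $\Sigma$, decides in $O(n^2)$ time whether $L = L(M)$ is prefix-closed; likewise whether $L$ is suffix-closed; likewise whether $L$ is subword-closed.
   Context: For words $v,w \in \Sigma^*$: $v$ is a prefix of $w$ if $w = vx$ for some $x$; $v$ is a suffix of $w$ if $w = xv$ for some $x$; $v$ is a subword of $w$ if $v$ can be obtained from $w$ by deleting some (not necessarily contiguous) letters, i.e. $v$ is a (scattered) subsequence of $w$. For such a relation $\unlhd$, a language $L$ is $\unlhd$-closed if whenever $w \in L$ and $v \unlhd w$, then $v \in L$. The alphabet $\Sigma$ is regarded as fixed in the running-time bound. *)

theory Defs
  imports Complex_Main "HOL-Library.Sublist" "HOL-Library.Landau_Symbols"
begin

section \<open>Deterministic finite automata\<close>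

record ('q, 'a) dfa =
  states :: "'q set"
  alphabet :: "'a set"
  start :: 'q
  final :: "'q set"
  delta :: "'q \<Rightarrow> 'a \<Rightarrow> 'q"

definition is_dfa :: "('q, 'a) dfa \<Rightarrow> bool" where
  "is_dfa M \<longleftrightarrow>
     finite (states M) \<and> finite (alphabet M) \<and>
     start M \<in> states M \<and> final M \<subseteq> states M \<and>
     (\<forall>q\<in>states M. \<forall>a\<in>alphabet M. delta M q a \<in> states M)"

definition language :: "('q, 'a) dfa \<Rightarrow> 'a list set" where
  "language M = {w \<in> lists (alphabet M). foldl (delta M) (start M) w \<in> final M}"

text \<open>Subwords are scattered: the relation is \<^const>\<open>subseq\<close>, not \<^const>\<open>sublist\<close>.\<close>

definition closed_under :: "('a list \<Rightarrow> 'a list \<Rightarrow> bool) \<Rightarrow> 'a list set \<Rightarrow> bool" where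
  "closed_under R L \<longleftrightarrow> (\<forall>w\<in>L. \<forall>v. R v w \<longrightarrow> v \<in> L)"


section \<open>Random access machines with unit cost\<close>

text \<open>
  The registers hold natural numbers and are initially zero; the input is a read-only
  sequence with random access. Every instruction costs one step. The arithmetic is restricted
  to addition and truncated subtraction, because multiplication at unit cost would make the
  model unreasonably powerful.
\<close>

datatype instr =
    Const nat nat
  | Add nat nat nat
  | Sub nat nat nat
  | Load nat nat
  | Store nat nat
  | Read nat nat
  | Jump nat
  | JumpZero nat nat
  | Accept
  | Reject

type_synonym program = "instr list"

text \<open>A configuration consists of the program counter and the register contents.\<close>

type_synonym config = "nat \<times> (nat \<Rightarrow> nat)"

definition input_at :: "nat list \<Rightarrow> nat \<Rightarrow> nat" where
  "input_at x i = (if i < length x then x ! i else 0)"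

fun exec :: "nat list \<Rightarrow> instr \<Rightarrow> config \<Rightarrow> config" where
  "exec x (Const i c) (pc, R) = (Suc pc, R(i := c))"
| "exec x (Add i j k) (pc, R) = (Suc pc, R(i := R j + R k))"
| "exec x (Sub i j k) (pc, R) = (Suc pc, R(i := R j - R k))"
| "exec x (Load i j) (pc, R) = (Suc pc, R(i := R (R j)))"
| "exec x (Store i j) (pc, R) = (Suc pc, R(R i := R j))"
| "exec x (Read i j) (pc, R) = (Suc pc, R(i := input_at x (R j)))"
| "exec x (Jump l) (pc, R) = (l, R)"
| "exec x (JumpZero i l) (pc, R) = (if R i = 0 then l else Suc pc, R)"
| "exec x Accept (pc, R) = (pc, R)"
| "exec x Reject (pc, R) = (pc, R)"

definition step :: "program \<Rightarrow> nat list \<Rightarrow> config \<Rightarrow> config" where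
  "step P x c = (if fst c < length P then exec x (P ! fst c) c else c)"

text \<open>
  A configuration at \<^const>\<open>Accept\<close> or \<^const>\<open>Reject\<close> is a fixed point of \<^const>\<open>step\<close>, so
  looking at the configuration after exactly \<open>t\<close> steps tells whether the machine has halted
  after at most \<open>t\<close> steps. A machine that leaves its program gives no answer.
\<close>

definition answers_within :: "program \<Rightarrow> nat list \<Rightarrow> nat \<Rightarrow> bool \<Rightarrow> bool" where
  "answers_within P x t b \<longleftrightarrow>
     (let pc = fst ((step P x ^^ t) (0, \<lambda>_. 0))
      in pc < length P \<and> P ! pc = (if b then Accept else Reject))"


section \<open>Automata as inputs of algorithms\<close>

definition position :: "'b list \<Rightarrow> 'b \<Rightarrow> nat" where
  "position xs x = length (takeWhile (\<lambda>y. y \<noteq> x) xs)"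

text \<open>
  States and letters are presented by their positions in the enumerations \<open>qs\<close> and \<open>as\<close>.
  The input consists of the numbers of letters and of states, the start state, one
  acceptance bit per state, and the transition table row by row, one row per state.
\<close>

definition encode_dfa :: "'q list \<Rightarrow> 'a list \<Rightarrow> ('q, 'a) dfa \<Rightarrow> nat list" where
  "encode_dfa qs as M =
     [length as, length qs, position qs (start M)] @
     map (\<lambda>q. if q \<in> final M then 1 else 0) qs @
     concat (map (\<lambda>q. map (\<lambda>a. position qs (delta M q a)) as) qs)"

text \<open>
  A single program serves all alphabets, but the time bound may depend on the alphabet,
  which is fixed before the bound \<open>T\<close>; \<open>T\<close> is a function of the number of states and has
  to hold for every enumeration of states and letters.
\<close>

definition dfa_decidable_in_time :: "(nat \<Rightarrow> real) \<Rightarrow> (('q, 'a) dfa \<Rightarrow> bool) \<Rightarrow> bool" where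
  "dfa_decidable_in_time g \<Phi> \<longleftrightarrow>
     (\<exists>P. \<forall>\<Sigma>. finite \<Sigma> \<longrightarrow>
       (\<exists>T :: nat \<Rightarrow> nat. (\<lambda>n. real (T n)) \<in> O(g) \<and>
         (\<forall>M qs as. is_dfa M \<longrightarrow> alphabet M = \<Sigma> \<longrightarrow>
            distinct qs \<longrightarrow> set qs = states M \<longrightarrow> distinct as \<longrightarrow> set as = \<Sigma> \<longrightarrow>
            answers_within P (encode_dfa qs as M) (T (card (states M))) (\<Phi> M))))"

end

theory Submission
  imports Defs
begin

text \<open>
  Each of the three relations \<open>R\<close> on words is generated from \<open>R [] []\<close> by appending one letter to the
  longer word and choosing, in one of two ways, what happens to the shorter one. Hence the pairs of
  states reached by pairs of related words are the nodes reachable from \<open>(s, s)\<close> in a graph with at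
  most \<open>n\<^sup>2\<close> nodes and two edges per node and letter, and the language fails to be closed exactly if
  a pair with rejecting first and accepting second component is reachable. One random access
  machine, with two parameters selecting the relation, decides this by breadth-first search.
\<close>

section \<open>Pairs of states reached by related words\<close>

text \<open>A choice says what becomes of the first component when the second advances by a letter:
  it returns to the start, is kept, advances by the same letter, or becomes the advanced second
  component.\<close>

datatype choice = Start | Stay | Move | Copy

fun pick :: "choice \<Rightarrow> 'b \<Rightarrow> 'b \<Rightarrow> 'b \<Rightarrow> 'b \<Rightarrow> 'b" where
  "pick Start s p p' q' = s"
| "pick Stay s p p' q' = p"
| "pick Move s p p' q' = p'"
| "pick Copy s p p' q' = q'"

text \<open>Naturality of the polymorphic \<open>pick\<close>: choices are transported from words to
  states along \<open>foldl \<delta> s\<close>, and between states and their positions.\<close>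

lemma pick_image: "pick c (f s) (f p) (f p') (f q') = f (pick c s p p' q')"
  by (cases c) auto

lemma pick_in: "s \<in> S \<Longrightarrow> p \<in> S \<Longrightarrow> p' \<in> S \<Longrightarrow> q' \<in> S \<Longrightarrow> pick c s p p' q' \<in> S"
  by (cases c) auto

inductive_set pairs :: "choice set \<Rightarrow> 'a set \<Rightarrow> ('q \<Rightarrow> 'a \<Rightarrow> 'q) \<Rightarrow> 'q \<Rightarrow> ('q \<times> 'q) set"
  for C A \<delta> s where
  pairs_start: "(s, s) \<in> pairs C A \<delta> s"
| pairs_step: "(p, q) \<in> pairs C A \<delta> s \<Longrightarrow> a \<in> A \<Longrightarrow> c \<in> C \<Longrightarrow>
    (pick c s p (\<delta> p a) (\<delta> q a), \<delta> q a) \<in> pairs C A \<delta> s"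

text \<open>The relation \<open>R\<close> is generated by the same choices, acting on words instead of states.\<close>

definition word_rule :: "choice set \<Rightarrow> ('a list \<Rightarrow> 'a list \<Rightarrow> bool) \<Rightarrow> bool" where
  "word_rule C R \<longleftrightarrow> (\<forall>v. R v [] \<longleftrightarrow> v = []) \<and>
     (\<forall>v w a. R v (w @ [a]) \<longleftrightarrow> (\<exists>u. R u w \<and> (\<exists>c\<in>C. v = pick c [] u (u @ [a]) (w @ [a]))))"

text \<open>\<open>Stay\<close> yields the prefixes of \<open>w\<close>, \<open>Copy\<close> the
  whole word. For suffixes \<open>Start\<close> yields the empty one and \<open>Move\<close> the
  nonempty ones; for subsequences \<open>Stay\<close> drops the last letter and \<open>Move\<close>
  matches it.\<close>

lemma word_rule_prefix: "word_rule {Stay, Copy} prefix"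
  unfolding word_rule_def by auto

lemma word_rule_suffix: "word_rule {Move, Start} suffix"
  unfolding word_rule_def by auto

lemma subseq_snoc_iff:
  "subseq v (w @ [a]) \<longleftrightarrow> subseq v w \<or> (\<exists>u. v = u @ [a] \<and> subseq u w)"
proof
  assume "subseq v (w @ [a])"
  then obtain v1 v2 where v: "v = v1 @ v2" "subseq v1 w" "subseq v2 [a]"
    using subseq_appendE by blast
  then have "v2 = [] \<or> v2 = [a]"
    by (cases v2) (auto split: if_splits)
  with v show "subseq v w \<or> (\<exists>u. v = u @ [a] \<and> subseq u w)"
    by auto
next
  assume "subseq v w \<or> (\<exists>u. v = u @ [a] \<and> subseq u w)"
  then show "subseq v (w @ [a])"
    by (auto simp: list_emb_append_mono intro: subseq_order.trans)
qed

lemma word_rule_subseq: "word_rule {Move, Stay} subseq"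
  unfolding word_rule_def by (auto simp: subseq_snoc_iff)

text \<open>Both sides grow at the right end: \<open>pairs_step\<close> follows one more letter, and
  \<open>word_rule\<close> describes \<open>w @ [a]\<close>. So rule induction gives one inclusion
  and induction on \<open>w\<close> from the right the other.\<close>

lemma pairs_eq_related_words:
  assumes "word_rule C R"
  shows "pairs C A \<delta> s = {(foldl \<delta> s v, foldl \<delta> s w) | v w. R v w \<and> w \<in> lists A}"
proof (intro equalityI subrelI)
  fix p q
  assume "(p, q) \<in> pairs C A \<delta> s"
  then show "(p, q) \<in> {(foldl \<delta> s v, foldl \<delta> s w) | v w. R v w \<and> w \<in> lists A}"
  proof induction
    case pairs_start
    have "R [] []"
      using assms by (simp add: word_rule_def)
    then show ?case
      by force
  next
    case (pairs_step p q a c)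
    then obtain u w where uw: "R u w" "w \<in> lists A" "p = foldl \<delta> s u" "q = foldl \<delta> s w"
      by blast
    let ?v = "pick c [] u (u @ [a]) (w @ [a])"
    have "R ?v (w @ [a])"
      using assms uw pairs_step by (auto simp: word_rule_def)
    moreover have "foldl \<delta> s ?v = pick c s p (\<delta> p a) (\<delta> q a)"
      using uw by (simp flip: pick_image[where f = "foldl \<delta> s"])
    moreover have "foldl \<delta> s (w @ [a]) = \<delta> q a" "w @ [a] \<in> lists A"
      using uw pairs_step by auto
    ultimately show ?case
      unfolding mem_Collect_eq by metis
  qed
next
  fix p q
  assume "(p, q) \<in> {(foldl \<delta> s v, foldl \<delta> s w) | v w. R v w \<and> w \<in> lists A}"
  then obtain v w where "R v w" "w \<in> lists A" and pq: "p = foldl \<delta> s v" "q = foldl \<delta> s w"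
    by blast
  then have "(foldl \<delta> s v, foldl \<delta> s w) \<in> pairs C A \<delta> s"
  proof (induction w arbitrary: v p q rule: rev_induct)
    case Nil
    then show ?case
      using assms by (auto simp: word_rule_def intro: pairs_start)
  next
    case (snoc a w)
    from assms snoc.prems(1) obtain u c where u: "R u w" "c \<in> C" "v = pick c [] u (u @ [a]) (w @ [a])"
      by (auto simp: word_rule_def)
    have "(foldl \<delta> s u, foldl \<delta> s w) \<in> pairs C A \<delta> s"
      using snoc u by auto
    then have "(pick c s (foldl \<delta> s u) (\<delta> (foldl \<delta> s u) a) (\<delta> (foldl \<delta> s w) a), \<delta> (foldl \<delta> s w) a)
        \<in> pairs C A \<delta> s"
      using snoc.prems u by (intro pairs_step) auto
    moreover have "pick c s (foldl \<delta> s u) (\<delta> (foldl \<delta> s u) a) (\<delta> (foldl \<delta> s w) a) = foldl \<delta> s v"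
      using pick_image[of c "foldl \<delta> s" "[]" u "u @ [a]" "w @ [a]"] u by simp
    ultimately show ?case
      by simp
  qed
  with pq show "(p, q) \<in> pairs C A \<delta> s"
    by simp
qed

lemma closed_under_iff_pairs:
  assumes "word_rule C R" and "\<And>v w. R v w \<Longrightarrow> set v \<subseteq> set w"
  shows "closed_under R (language M) \<longleftrightarrow>
    (\<forall>(p, q) \<in> pairs C (alphabet M) (delta M) (start M). q \<in> final M \<longrightarrow> p \<in> final M)"
proof -
  let ?run = "foldl (delta M) (start M)"
  have "closed_under R (language M) \<longleftrightarrow>
      (\<forall>v w. R v w \<longrightarrow> w \<in> lists (alphabet M) \<longrightarrow> ?run w \<in> final M \<longrightarrow> ?run v \<in> final M)"
    \<comment> \<open>By the second assumption \<open>v\<close> uses only letters of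
      \<open>w\<close>, so it can leave the language only by not being accepted.\<close>
    using assms(2) unfolding closed_under_def language_def in_lists_conv_set mem_Collect_eq by blast
  then show ?thesis
    unfolding pairs_eq_related_words[OF assms(1)] by blast
qed


section \<open>Running random access machines\<close>

text \<open>The initial configuration is arbitrary so that a run can be cut into segments.\<close>

definition answers_from :: "program \<Rightarrow> nat list \<Rightarrow> config \<Rightarrow> nat \<Rightarrow> bool \<Rightarrow> bool" where
  "answers_from P x c t b \<longleftrightarrow>
     (let pc = fst ((step P x ^^ t) c) in pc < length P \<and> P ! pc = (if b then Accept else Reject))"

lemma answers_within_iff: "answers_within P x t b \<longleftrightarrow> answers_from P x (0, \<lambda>_. 0) t b"
  by (simp add: answers_within_def answers_from_def)

text \<open>The halting instructions are fixed points of \<open>step\<close>, so an answer persists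
  and time bounds may be rounded up.\<close>

lemma answers_from_Suc: "answers_from P x c t b \<Longrightarrow> answers_from P x c (Suc t) b"
  by (cases "(step P x ^^ t) c") (auto simp: answers_from_def step_def Let_def split: if_splits)

lemma answers_from_mono: "answers_from P x c t b \<Longrightarrow> t \<le> t' \<Longrightarrow> answers_from P x c t' b"
  by (rotate_tac, induction t' rule: dec_induct) (auto intro: answers_from_Suc)

lemma answers_from_funpow:
  assumes "(step P x ^^ j) c = c'" "answers_from P x c' t b" "j + t \<le> t'"
  shows "answers_from P x c t' b"
proof -
  have "answers_from P x c (t + j) b"
    using assms(1,2) by (auto simp: answers_from_def funpow_add)
  then show ?thesis
    using assms(3) by (auto intro: answers_from_mono)
qed

text \<open>Steps are peeled off at the beginning of the run, so that the simplifier executes a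
  program symbolically, instruction by instruction.\<close>

lemma funpow_numeral: "(f ^^ numeral m) y = (f ^^ pred_numeral m) (f y)"
  by (simp add: numeral_eq_Suc funpow_swap1)

lemma step_eq_exec: "pc < length P \<Longrightarrow> step P x (pc, R) = exec x (P ! pc) (pc, R)"
  by (simp add: step_def)


section \<open>The program\<close>

text \<open>
  Registers: 0, 1, 5, 6 hold the constants 0, 1, 3, 32; 2 the number \<open>k\<close> of letters; 3 the number
  \<open>n\<close> of states; 4 the start state; 7 the number \<open>32 + n\<close>; 11 and 12 the addresses of the head and
  the tail of the queue; 13 a letter \<open>a\<close>; 14 and 15 the states \<open>p\<close> and \<open>q\<close> of the current pair;
  16 and 17 the input positions of their rows of the transition table; 18 and 19 their successors
  under \<open>a\<close>. The remaining registers below 32 are scratch. As there is no multiplication, the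
  multiples of \<open>n\<close> and \<open>k\<close> that are needed as row offsets are tabulated first: for \<open>i < n\<close>,
  register \<open>32 + i\<close> holds the address of row \<open>i\<close> of the \<open>n \<times> n\<close> matrix of visited marks, and
  register \<open>32 + n + i\<close> the input position of row \<open>i\<close> of the transition table. The matrix starts at
  \<open>32 + 2 * n\<close> and is followed by the queue, which takes two registers per pair.
  Addresses: the loop filling the tables starts at 10, the loop over the queue at 34, the loop over
  the letters at 51.
\<close>

fun reg :: "choice \<Rightarrow> nat" where
  "reg Start = 4"
| "reg Stay = 14"
| "reg Move = 18"
| "reg Copy = 19"

definition push :: "nat \<Rightarrow> nat \<Rightarrow> program" where
  "push B z =
    [Add 20 6 z, Load 20 20, Add 20 20 19, Load 21 20, JumpZero 21 (B + 6), Jump (B + 11),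
     Store 20 1, Store 12 z, Add 12 12 1, Store 12 19, Add 12 12 1]"

definition closure_program :: "choice \<Rightarrow> choice \<Rightarrow> program" where
  "closure_program c1 c2 =
    [Const 1 1, Const 5 3, Const 6 32, Read 2 0, Read 3 1, Const 20 2, Read 4 20,
     Add 7 6 3, Add 9 7 3, Add 10 5 3] @
    [Sub 20 3 8, JumpZero 20 20, Add 21 6 8, Store 21 9, Add 21 7 8, Store 21 10,
     Add 9 9 3, Add 10 10 2, Add 8 8 1, Jump 10] @
    [Add 11 9 0, Add 12 9 0, Add 19 4 0] @ push 23 4 @
    [Sub 20 12 11, JumpZero 20 81, Load 14 11, Add 11 11 1, Load 15 11, Add 11 11 1,
     Add 20 5 15, Read 20 20, JumpZero 20 46, Add 20 5 14, Read 20 20, JumpZero 20 82,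
     Add 16 7 14, Load 16 16, Add 17 7 15, Load 17 17, Const 13 0] @
    [Sub 20 2 13, JumpZero 20 34, Add 20 16 13, Read 18 20, Add 20 17 13, Read 19 20] @
    push 57 (reg c1) @ push 68 (reg c2) @
    [Add 13 13 1, Jump 51, Accept, Reject]"

text \<open>The three copies of \<open>push\<close> differ in their address and hence in their jump
  targets; \<open>code_at\<close> allows one analysis for all of them.\<close>

definition code_at :: "program \<Rightarrow> nat \<Rightarrow> program \<Rightarrow> bool" where
  "code_at P B is \<longleftrightarrow> (\<exists>pre post. P = pre @ is @ post \<and> length pre = B)"

lemma code_at_nth: "code_at P B is \<Longrightarrow> i < length is \<Longrightarrow> P ! (B + i) = is ! i \<and> B + i < length P"
  by (auto simp: code_at_def nth_append)

lemma length_closure_program: "length (closure_program c1 c2) = 83"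
  by (simp add: closure_program_def push_def)

lemma code_atI:
  "P = take B P @ is @ drop (B + length is) P \<Longrightarrow> B \<le> length P \<Longrightarrow> code_at P B is"
  unfolding code_at_def by (rule exI[of _ "take B P"]) auto

lemma code_at_push:
  "code_at (closure_program c1 c2) 23 (push 23 4)"
  "code_at (closure_program c1 c2) 57 (push 57 (reg c1))"
  "code_at (closure_program c1 c2) 68 (push 68 (reg c2))"
  by (rule code_atI; simp add: closure_program_def push_def)+


lemma closure_program_nth:
  fixes c1 c2
  defines "P \<equiv> closure_program c1 c2"
  shows
    "P ! 0 = Const 1 1" "P ! Suc 0 = Const 5 3" "P ! 2 = Const 6 32" "P ! 3 = Read 2 0"
    "P ! 4 = Read 3 1" "P ! 5 = Const 20 2" "P ! 6 = Read 4 20" "P ! 7 = Add 7 6 3"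
    "P ! 8 = Add 9 7 3" "P ! 9 = Add 10 5 3" "P ! 10 = Sub 20 3 8" "P ! 11 = JumpZero 20 20"
    "P ! 12 = Add 21 6 8" "P ! 13 = Store 21 9" "P ! 14 = Add 21 7 8" "P ! 15 = Store 21 10"
    "P ! 16 = Add 9 9 3" "P ! 17 = Add 10 10 2" "P ! 18 = Add 8 8 1" "P ! 19 = Jump 10"
    "P ! 20 = Add 11 9 0" "P ! 21 = Add 12 9 0" "P ! 22 = Add 19 4 0"
    "P ! 34 = Sub 20 12 11" "P ! 35 = JumpZero 20 81" "P ! 36 = Load 14 11" "P ! 37 = Add 11 11 1"
    "P ! 38 = Load 15 11" "P ! 39 = Add 11 11 1" "P ! 40 = Add 20 5 15" "P ! 41 = Read 20 20"
    "P ! 42 = JumpZero 20 46" "P ! 43 = Add 20 5 14" "P ! 44 = Read 20 20"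
    "P ! 45 = JumpZero 20 82" "P ! 46 = Add 16 7 14" "P ! 47 = Load 16 16" "P ! 48 = Add 17 7 15"
    "P ! 49 = Load 17 17" "P ! 50 = Const 13 0" "P ! 51 = Sub 20 2 13" "P ! 52 = JumpZero 20 34"
    "P ! 53 = Add 20 16 13" "P ! 54 = Read 18 20" "P ! 55 = Add 20 17 13" "P ! 56 = Read 19 20"
    "P ! 79 = Add 13 13 1" "P ! 80 = Jump 51" "P ! 81 = Accept" "P ! 82 = Reject"
  unfolding P_def by (simp_all add: closure_program_def push_def)


section \<open>Correctness of the search\<close>

text \<open>Models the effect of \<open>push\<close>. Pairs are never removed from the list; the
  head pointer separates the processed ones from the pending ones.\<close>

definition visit :: "'b list \<Rightarrow> 'b \<Rightarrow> 'b list" where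
  "visit Q z = (if z \<in> set Q then Q else Q @ [z])"

lemma set_visit: "set (visit Q z) = insert z (set Q)"
  by (auto simp: visit_def)

lemma nth_visit: "j < length Q \<Longrightarrow> visit Q z ! j = Q ! j"
  by (simp add: visit_def nth_append)

lemma length_visit: "length Q \<le> length (visit Q z)"
  by (simp add: visit_def)

lemma row_index_less: "i < n \<Longrightarrow> j < k \<Longrightarrow> i * k + j < n * (k::nat)"
proof -
  assume "i < n" "j < k"
  then have "i * k + j < Suc i * k" "Suc i * k \<le> n * k"
    by (simp, intro mult_le_mono1) auto
  then show ?thesis
    by simp
qed

text \<open>States and letters are numbers here, and the input is known only through the values the
  program reads, which keeps the analysis independent of the encoding.\<close>

locale search =
  fixes x :: "nat list" and n k s :: nat and fin :: "nat set" and d :: "nat \<Rightarrow> nat \<Rightarrow> nat"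
    and c1 c2 :: choice
  assumes start_less: "s < n"
    and succ_less: "p < n \<Longrightarrow> a < k \<Longrightarrow> d p a < n"
    and input_letters: "input_at x 0 = k"
    and input_states: "input_at x (Suc 0) = n"
    and input_start: "input_at x 2 = s"
    and input_final: "p < n \<Longrightarrow> input_at x (3 + p) = of_bool (p \<in> fin)"
    and input_succ: "p < n \<Longrightarrow> a < k \<Longrightarrow> input_at x (3 + n + p * k + a) = d p a"
begin

abbreviation P :: program where
  "P \<equiv> closure_program c1 c2"

abbreviation reachable :: "(nat \<times> nat) set" where
  "reachable \<equiv> pairs {c1, c2} {..<k} d s"

section \<open>Memory layout and insertion into the queue\<close>

definition mark :: "nat \<Rightarrow> nat \<Rightarrow> nat" where
  "mark p q = 32 + 2 * n + (p * n + q)"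

definition queue :: nat where
  "queue = 32 + 2 * n + n * n"

lemma mark_ge: "32 + 2 * n \<le> mark p q"
  by (simp add: mark_def)

lemma mark_less: "p < n \<Longrightarrow> q < n \<Longrightarrow> mark p q < queue"
  using row_index_less[of p n q n] by (simp add: mark_def queue_def)

lemma mark_eq_iff: "q < n \<Longrightarrow> q' < n \<Longrightarrow> mark p q = mark p' q' \<longleftrightarrow> p = p' \<and> q = q'"
proof -
  assume q: "q < n" "q' < n"
  have "p = p' \<and> q = q'" if "p * n + q = p' * n + q'"
    using arg_cong[OF that, of "\<lambda>m. m div n"] arg_cong[OF that, of "\<lambda>m. m mod n"] q by auto
  then show ?thesis
    by (auto simp: mark_def)
qed

text \<open>\<open>Q\<close> lists all pairs discovered so far, including those already taken from
  the queue. The head pointer in register 11 is left to the loop invariants, since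
  \<open>push\<close> does not change it.\<close>

definition mem :: "(nat \<times> nat) list \<Rightarrow> (nat \<Rightarrow> nat) \<Rightarrow> bool" where
  "mem Q R \<longleftrightarrow>
     R 0 = 0 \<and> R (Suc 0) = 1 \<and> R 2 = k \<and> R 3 = n \<and> R 4 = s \<and> R 5 = 3 \<and> R 6 = 32 \<and> R 7 = 32 + n \<and>
     R 12 = queue + 2 * length Q \<and> distinct Q \<and> set Q \<subseteq> {..<n} \<times> {..<n} \<and>
     (\<forall>i<n. R (32 + i) = mark i 0) \<and>
     (\<forall>i<n. R (32 + n + i) = 3 + n + i * k) \<and>
     (\<forall>p<n. \<forall>q<n. R (mark p q) = of_bool ((p, q) \<in> set Q)) \<and>
     (\<forall>j<length Q. R (queue + 2 * j) = fst (Q ! j) \<and> R (queue + 2 * j + 1) = snd (Q ! j))"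

lemma mem_cong:
  assumes "\<And>r. r \<ge> 32 \<or> r < 8 \<or> r = 12 \<Longrightarrow> R' r = R r"
  shows "mem Q R' = mem Q R"
proof -
  have "R' (mark p q) = R (mark p q)" for p q
    using mark_ge[of p q] by (intro assms) auto
  then show ?thesis
    unfolding mem_def by (simp add: assms queue_def)
qed

lemma mem_upd: "r < 32 \<Longrightarrow> 8 \<le> r \<Longrightarrow> r \<noteq> 12 \<Longrightarrow> mem Q (R(r := v)) = mem Q R"
  by (rule mem_cong) auto

text \<open>The writes do not interfere: the mark lies between the tables and the queue, distinct
  pairs have distinct marks, and the new entry lies just behind the old ones.\<close>

lemma mem_append:
  assumes mem: "mem Q R" and z: "p < n" "q < n" "(p, q) \<notin> set Q"
  shows "mem (Q @ [(p, q)]) (R(mark p q := 1, queue + 2 * length Q := p,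
    queue + 2 * length Q + 1 := q, 12 := queue + 2 * length Q + 2))" (is "mem _ ?R")
proof -
  note [simp] = mark_eq_iff z
  have m: "32 + 2 * n \<le> mark p q" "mark p q < queue" "32 + 2 * n \<le> queue"
    using mark_ge mark_less z by (auto simp: queue_def)
  have marks: "?R (mark p' q') = of_bool ((p', q') \<in> set (Q @ [(p, q)]))"
    if "p' < n" "q' < n" for p' q'
    using m mark_ge[of p' q'] mark_less[OF that] that mem by (auto simp: mem_def)
  have entries: "?R (queue + 2 * j) = fst ((Q @ [(p, q)]) ! j)"
    "?R (queue + 2 * j + 1) = snd ((Q @ [(p, q)]) ! j)"
    if "j < length (Q @ [(p, q)])" for j
    using m that mem by (auto simp: mem_def nth_append less_Suc_eq)
  have low: "?R r = R r" if "r < 32 + 2 * n" "r \<noteq> 12" for r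
    using m that by auto
  have tables: "?R (32 + i) = mark i 0" "?R (32 + n + i) = 3 + n + i * k" if "i < n" for i
    using mem low[of "32 + i"] low[of "32 + n + i"] that by (auto simp: mem_def)
  have queue: "?R 12 = queue + 2 * length (Q @ [(p, q)])"
    "distinct (Q @ [(p, q)])" "set (Q @ [(p, q)]) \<subseteq> {..<n} \<times> {..<n}"
    using mem z by (auto simp: mem_def)
  have regs: "?R 0 = 0" "?R (Suc 0) = 1" "?R 2 = k" "?R 3 = n" "?R 4 = s" "?R 5 = 3" "?R 6 = 32"
    "?R 7 = 32 + n"
    using mem low[of 0] low[of "Suc 0"] low[of 2] low[of 3] low[of 4] low[of 5] low[of 6] low[of 7]
    by (simp_all add: mem_def)
  show ?thesis
    unfolding mem_def
    by (intro conjI allI impI; rule regs queue tables marks entries; assumption)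
qed

text \<open>A marked pair costs 6 steps, a new one 10; both paths end at \<open>B + 11\<close>.
  Register \<open>z\<close> must avoid 12, 20 and 21, which are overwritten.\<close>

lemma push:
  assumes code: "code_at P' B (push B z)" and mem: "mem Q R"
    and z: "z < 32" "z \<noteq> 12" "z \<noteq> 20" "z \<noteq> 21" "R z < n" and q: "R 19 < n"
  shows "\<exists>R' t. t \<le> 11 \<and> (step P' x ^^ t) (B, R) = (B + 11, R') \<and>
    mem (visit Q (R z, R 19)) R' \<and> (\<forall>r<32. r \<notin> {12, 20, 21} \<longrightarrow> R' r = R r)"
proof -
  let ?m = "mark (R z) (R 19)"
  have nth: "P' ! B = Add 20 6 z" "P' ! Suc B = Load 20 20" "P' ! (B + 2) = Add 20 20 19"
    "P' ! (B + 3) = Load 21 20" "P' ! (B + 4) = JumpZero 21 (B + 6)" "P' ! (B + 5) = Jump (B + 11)"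
    "P' ! (B + 6) = Store 20 1" "P' ! (B + 7) = Store 12 z" "P' ! (B + 8) = Add 12 12 1"
    "P' ! (B + 9) = Store 12 19" "P' ! (B + 10) = Add 12 12 1"
    and len: "B + 10 < length P'"
    using code_at_nth[OF code, of 0] code_at_nth[OF code, of 1] code_at_nth[OF code, of 2]
      code_at_nth[OF code, of 3] code_at_nth[OF code, of 4] code_at_nth[OF code, of 5]
      code_at_nth[OF code, of 6] code_at_nth[OF code, of 7] code_at_nth[OF code, of 8]
      code_at_nth[OF code, of 9] code_at_nth[OF code, of 10]
    by (simp_all add: push_def)
  have m: "32 + 2 * n \<le> ?m" "?m < queue"
    using mark_ge mark_less z q by auto
  have mem': "R (Suc 0) = 1" "R 6 = 32" "R (32 + R z) = mark (R z) 0" "R 12 = queue + 2 * length Q"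
    "R ?m = of_bool ((R z, R 19) \<in> set Q)" "mark (R z) 0 + R 19 = ?m"
    using mem z q by (auto simp: mem_def mark_def)
  \<comment> \<open>Keeps addresses in the form \<open>B + numeral\<close>, in which the
    instructions are looked up.\<close>
  have Suc: "\<And>i. Suc (B + numeral i) = B + numeral (Num.inc i)" "Suc (Suc B) = B + 2"
    by (simp_all add: add_One)
  \<comment> \<open>After four instructions register 20 holds the address of the mark and register
    21 the mark itself.\<close>
  let ?R = "R(20 := ?m, 21 := R ?m)"
  have 4: "(step P' x ^^ 4) (B, R) = (B + 4, ?R)"
    using z m len mem' by (simp add: funpow_numeral step_eq_exec nth Suc del: add_Suc_right add_2_eq_Suc')
  show ?thesis
  proof (cases "(R z, R 19) \<in> set Q")
    case True
    have "(step P' x ^^ 2) (B + 4, ?R) = (B + 11, ?R)"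
      using True m len mem' by (simp add: funpow_numeral step_eq_exec nth Suc del: add_Suc_right add_2_eq_Suc')
    with 4 have "(step P' x ^^ 6) (B, R) = (B + 11, ?R)"
      using funpow_add[of 2 4 "step P' x"] by simp
    moreover have "mem (visit Q (R z, R 19)) ?R"
      using True mem by (simp add: visit_def mem_upd)
    ultimately show ?thesis
      by (intro exI[of _ ?R] exI[of _ 6]) auto
  next
    case False
    let ?R' = "?R(?m := 1, queue + 2 * length Q := R z,
        queue + 2 * length Q + 1 := R 19, 12 := queue + 2 * length Q + 2)"
    have "(step P' x ^^ 6) (B + 4, ?R) = (B + 11, ?R')"
      using False m len mem' z
      by (simp add: funpow_numeral step_eq_exec nth Suc fun_eq_iff del: add_Suc_right add_2_eq_Suc')
    with 4 have "(step P' x ^^ 10) (B, R) = (B + 11, ?R')"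
      using funpow_add[of 6 4 "step P' x"] by simp
    moreover have "mem (visit Q (R z, R 19)) ?R'"
      using mem_append[of Q ?R "R z" "R 19"] False mem z q by (simp add: visit_def mem_upd)
    moreover have "\<forall>r<32. r \<notin> {12, 20, 21} \<longrightarrow> ?R' r = R r"
      using m by auto
    ultimately show ?thesis
      by (intro exI[of _ ?R'] exI[of _ 10]) auto
  qed
qed

section \<open>Filling the tables and starting the queue\<close>

lemmas run_simps =
  funpow_numeral step_eq_exec length_closure_program closure_program_nth numeral_2_eq_2[symmetric]

text \<open>Registers 9 and 10 carry the next row addresses, obtained by repeated addition. The last
  clause lets untouched registers serve as a matrix without marks.\<close>

definition init_inv :: "nat \<Rightarrow> (nat \<Rightarrow> nat) \<Rightarrow> bool" where
  "init_inv i R \<longleftrightarrow> i \<le> n \<and>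
     R 0 = 0 \<and> R (Suc 0) = 1 \<and> R 2 = k \<and> R 3 = n \<and> R 4 = s \<and> R 5 = 3 \<and> R 6 = 32 \<and> R 7 = 32 + n \<and>
     R 8 = i \<and> R 9 = mark i 0 \<and> R 10 = 3 + n + i * k \<and>
     (\<forall>j<i. R (32 + j) = mark j 0) \<and> (\<forall>j<i. R (32 + n + j) = 3 + n + j * k) \<and>
     (\<forall>r \<ge> 32 + 2 * n. R r = 0)"

lemma init_start: "\<exists>R. (step P x ^^ 10) (0, \<lambda>_. 0) = (10, R) \<and> init_inv 0 R"
  \<comment> \<open>The counter in register 8 is never set explicitly; it starts from the initial
    zero.\<close>
  by (simp add: run_simps input_letters input_states input_start init_inv_def mark_def)

lemma init_step:
  assumes inv: "init_inv i R" and i: "i < n"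
  shows "\<exists>R'. (step P x ^^ 10) (10, R) = (10, R') \<and> init_inv (Suc i) R'"
proof -
  have regs: "R (Suc 0) = 1" "R 2 = k" "R 3 = n" "R 6 = 32" "R 7 = 32 + n" "R 8 = i"
    "R 9 = mark i 0" "R 10 = 3 + n + i * k"
    using inv by (auto simp: init_inv_def)
  let ?R = "R(20 := n - i, 21 := 32 + n + i, 32 + i := mark i 0, 32 + n + i := 3 + n + i * k,
    9 := mark (Suc i) 0, 10 := 3 + n + Suc i * k, 8 := Suc i)"
  have "(step P x ^^ 10) (10, R) = (10, ?R)"
    using i regs by (auto simp: run_simps mark_def fun_eq_iff)
  moreover have "init_inv (Suc i) ?R"
    using inv i by (auto simp: init_inv_def less_Suc_eq)
  ultimately show ?thesis
    by blast
qed

lemma init_loop: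
  "init_inv i R \<Longrightarrow> \<exists>R' t. t \<le> 10 * (n - i) + 2 \<and> (step P x ^^ t) (10, R) = (20, R') \<and> init_inv n R'"
proof (induction "n - i" arbitrary: i R)
  case 0
  then have "i = n" "R 3 = n" "R 8 = n"
    by (auto simp: init_inv_def)
  then have "(step P x ^^ 2) (10, R) = (20, R(20 := 0))" "init_inv n (R(20 := 0))"
    using 0 by (auto simp: run_simps init_inv_def)
  then show ?case
    by (meson le_add2)
next
  case (Suc m)
  then have i: "i < n"
    by simp
  from init_step[OF Suc.prems i] obtain R1
    where R1: "(step P x ^^ 10) (10, R) = (10, R1)" "init_inv (Suc i) R1"
    by blast
  have "m = n - Suc i"
    using Suc.hyps(2) by simp
  from Suc.hyps(1)[OF this R1(2)] obtain R' t
    where R': "t \<le> 10 * (n - Suc i) + 2" "(step P x ^^ t) (10, R1) = (20, R')" "init_inv n R'"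
    by blast
  have "(step P x ^^ (t + 10)) (10, R) = (20, R')"
    using R1(1) R'(2) by (simp only: funpow_add o_apply)
  moreover have "t + 10 \<le> 10 * (n - i) + 2"
    using R' i by simp
  ultimately show ?case
    using R' by blast
qed

lemma init:
  "\<exists>R t. t \<le> 10 * n + 26 \<and> (step P x ^^ t) (0, \<lambda>_. 0) = (34, R) \<and> mem [(s, s)] R \<and> R 11 = queue"
proof -
  from init_start obtain R0 where R0: "(step P x ^^ 10) (0, \<lambda>_. 0) = (10, R0)" "init_inv 0 R0"
    by blast
  from init_loop[OF R0(2)] obtain R1 t1
    where R1: "t1 \<le> 10 * n + 2" "(step P x ^^ t1) (10, R0) = (20, R1)" "init_inv n R1"
    by auto
  \<comment> \<open>Row \<open>n\<close> would begin right behind the matrix, so register 9 ends up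
    with the address of the queue.\<close>
  have [simp]: "mark n 0 = queue" "32 + 2 * n \<le> queue + j" for j
    by (simp_all add: mark_def queue_def)
  let ?R = "R1(11 := queue, 12 := queue, 19 := s)"
  have R2: "(step P x ^^ 3) (20, R1) = (23, ?R)"
    using R1(3) by (auto simp: run_simps init_inv_def fun_eq_iff)
  have "?R (mark p q) = 0" for p q
    using mark_ge[of p q] R1(3) by (simp add: init_inv_def)
  then have "mem [] ?R"
    using R1(3) unfolding mem_def init_inv_def by simp
  then obtain R3 t3
    where R3: "t3 \<le> 11" "(step P x ^^ t3) (23, ?R) = (34, R3)" "mem (visit [] (s, s)) R3"
      "\<forall>r<32. r \<notin> {12, 20, 21} \<longrightarrow> R3 r = ?R r"
    using push[OF code_at_push(1)[of c1 c2], of "[]" ?R] start_less R1(3)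
    by (auto simp: init_inv_def)
  have "(step P x ^^ (t3 + (3 + (t1 + 10)))) (0, \<lambda>_. 0) = (34, R3)"
    unfolding funpow_add o_apply R0 R1 R2 R3 ..
  moreover have "t3 + (3 + (t1 + 10)) \<le> 10 * n + 26"
    using R1 R3 by simp
  moreover have "R3 11 = queue"
    using R3(4) by simp
  moreover have "mem [(s, s)] R3"
    using R3(3) by (simp add: visit_def)
  ultimately show ?thesis
    by blast
qed

section \<open>Invariants of the breadth-first search\<close>

definition expanded :: "(nat \<times> nat) list \<Rightarrow> nat \<times> nat \<Rightarrow> nat \<Rightarrow> bool" where
  "expanded Q z a \<longleftrightarrow> (\<forall>c\<in>{c1, c2}.
     (pick c s (fst z) (d (fst z) a) (d (snd z) a), d (snd z) a) \<in> set Q)"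

definition harmless :: "nat \<times> nat \<Rightarrow> bool" where
  "harmless z \<longleftrightarrow> (snd z \<in> fin \<longrightarrow> fst z \<in> fin)"

definition search_inv :: "nat \<Rightarrow> (nat \<times> nat) list \<Rightarrow> bool" where
  "search_inv h Q \<longleftrightarrow> h \<le> length Q \<and> (s, s) \<in> set Q \<and> set Q \<subseteq> reachable \<and>
     (\<forall>j<h. harmless (Q ! j) \<and> (\<forall>a<k. expanded Q (Q ! j) a))"

definition head_inv :: "nat \<Rightarrow> (nat \<times> nat) list \<Rightarrow> (nat \<Rightarrow> nat) \<Rightarrow> bool" where
  "head_inv h Q R \<longleftrightarrow> mem Q R \<and> R 11 = queue + 2 * h \<and> search_inv h Q"

text \<open>Register 11 has already moved past the pair at index \<open>h\<close>, while
  \<open>search_inv\<close> still counts this pair as unprocessed; its letters below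
  \<open>a\<close> are done.\<close>

definition letter_inv :: "nat \<Rightarrow> nat \<Rightarrow> (nat \<times> nat) list \<Rightarrow> (nat \<Rightarrow> nat) \<Rightarrow> bool" where
  "letter_inv h a Q R \<longleftrightarrow> mem Q R \<and> R 11 = queue + 2 * Suc h \<and> search_inv h Q \<and> h < length Q \<and>
     Q ! h = (R 14, R 15) \<and> harmless (Q ! h) \<and> (\<forall>b<a. expanded Q (Q ! h) b) \<and>
     R 16 = 3 + n + R 14 * k \<and> R 17 = 3 + n + R 15 * k \<and> R 13 = a \<and> a \<le> k"

lemma expanded_mono: "expanded Q z a \<Longrightarrow> set Q \<subseteq> set Q' \<Longrightarrow> expanded Q' z a"
  by (auto simp: expanded_def)

lemma search_inv_visit:
  assumes inv: "search_inv h Q" and z: "z \<in> reachable"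
  shows "search_inv h (visit Q z)"
proof -
  have "harmless (visit Q z ! j) \<and> (\<forall>a<k. expanded (visit Q z) (visit Q z ! j) a)" if "j < h" for j
  proof -
    have "visit Q z ! j = Q ! j"
      using inv that by (simp add: search_inv_def nth_visit)
    moreover have "harmless (Q ! j)" "\<forall>a<k. expanded Q (Q ! j) a"
      using inv that by (simp_all add: search_inv_def)
    moreover have "set Q \<subseteq> set (visit Q z)"
      by (auto simp: set_visit)
    ultimately show ?thesis
      by (metis expanded_mono)
  qed
  moreover have "h \<le> length (visit Q z)"
    using inv length_visit[of Q z] by (simp add: search_inv_def)
  ultimately show ?thesis
    using inv z by (simp add: search_inv_def set_visit)
qed

text \<open>With every entry expanded, the queue contains the start pair and is closed under the
  steps of \<open>pairs\<close>.\<close>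

lemma reachable_eq_queue:
  assumes inv: "search_inv (length Q) Q"
  shows "reachable = set Q"
proof
  show "set Q \<subseteq> reachable"
    using inv by (simp add: search_inv_def)
  have "(p, q) \<in> set Q" if "(p, q) \<in> reachable" for p q
    using that
  proof induction
    case pairs_start
    then show ?case
      using inv by (simp add: search_inv_def)
  next
    case (pairs_step p q a c)
    then have "expanded Q (p, q) a"
      using inv by (auto simp: search_inv_def in_set_conv_nth)
    then show ?case
      using pairs_step by (auto simp: expanded_def)
  qed
  then show "reachable \<subseteq> set Q"
    by auto
qed

abbreviation answer :: bool where
  "answer \<equiv> \<forall>z\<in>reachable. harmless z"

section \<open>The loops over the queue and over the letters\<close>

lemma head_finish:
  assumes "head_inv h Q R" "h = length Q"
  shows "answers_from P x (34, R) 2 answer"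
proof -
  have answer
    using assms reachable_eq_queue[of Q]
    by (metis head_inv_def search_inv_def in_set_conv_nth)
  moreover have "R 11 = R 12"
    using assms by (simp add: head_inv_def mem_def)
  ultimately show ?thesis
    by (simp add: answers_from_def run_simps)
qed

text \<open>The bound 17 consists of 8 steps for taking the pair and reading the bit of
  \<open>q\<close>, at most 4 for the test, and 5 for preparing the letter loop. A harmful pair
  leads to rejection after 12.\<close>

lemma head_step:
  assumes inv: "head_inv h Q R" and h: "h < length Q"
  shows "answers_from P x (34, R) 17 answer \<or>
    (\<exists>R' t. t \<le> 17 \<and> (step P x ^^ t) (34, R) = (51, R') \<and> letter_inv h 0 Q R')"
proof -
  obtain p q where pq: "Q ! h = (p, q)"
    by (cases "Q ! h")
  then have mem_pq: "(p, q) \<in> set Q"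
    using h nth_mem by fastforce
  have mem: "mem Q R" and R11: "R 11 = queue + 2 * h"
    using inv by (auto simp: head_inv_def)
  then have less: "p < n" "q < n"
    using mem_pq by (auto simp: mem_def)
  have queue: "R (queue + 2 * h) = p" "R (Suc (queue + 2 * h)) = q" "R 12 - R 11 > 0" "queue \<ge> 32"
    using mem R11 h pq by (auto simp: mem_def queue_def)
  have regs: "R (Suc 0) = 1" "R 5 = 3" "R 7 = 32 + n" "R (32 + n + p) = 3 + n + p * k"
    "R (32 + n + q) = 3 + n + q * k"
    using mem less by (auto simp: mem_def)
  let ?R = "R(14 := p, 11 := Suc (Suc (queue + 2 * h)), 15 := q, 20 := of_bool (q \<in> fin))"
  have pop: "(step P x ^^ 8) (34, R) = (42, ?R)"
    using queue R11 regs input_final[OF less(2)]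
    by (auto simp: run_simps fun_eq_iff)
  show ?thesis
  proof (cases "harmless (p, q)")
    case False
    then have "q \<in> fin" "p \<notin> fin"
      by (auto simp: harmless_def)
    then have "(step P x ^^ 4) (42, ?R) = (82, ?R(20 := 0))"
      using regs input_final[OF less(1)] by (simp add: run_simps)
    with pop have run: "(step P x ^^ 12) (34, R) = (82, ?R(20 := 0))"
      using funpow_add[of 4 8 "step P x"] by simp
    have "\<not> answer"
      using False mem_pq inv by (auto simp: head_inv_def search_inv_def)
    then have "answers_from P x (82, ?R(20 := 0)) 0 answer"
      by (auto simp: answers_from_def run_simps)
    with run have "answers_from P x (34, R) 17 answer"
      by (rule answers_from_funpow) simp
    then show ?thesis
      by simp
  next
    case True
    \<comment> \<open>A rejecting \<open>q\<close> skips the test of \<open>p\<close>, so the number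
      of steps and the content of register 20 vary.\<close>
    have "\<exists>v t. t \<le> 4 \<and> (step P x ^^ t) (42, ?R) = (46, ?R(20 := v))"
    proof (cases "q \<in> fin")
      case q: True
      with True have "p \<in> fin"
        by (simp add: harmless_def)
      with q have "(step P x ^^ 4) (42, ?R) = (46, ?R(20 := 1))"
        using regs input_final[OF less(1)] by (simp add: run_simps)
      then show ?thesis
        by blast
    next
      case False
      then have "(step P x ^^ 1) (42, ?R) = (46, ?R(20 := 0))"
        by (simp add: run_simps)
      moreover have "(1::nat) \<le> 4"
        by simp
      ultimately show ?thesis
        by blast
    qed
    then obtain v t where t: "t \<le> 4" "(step P x ^^ t) (42, ?R) = (46, ?R(20 := v))"
      by blast
    let ?R' = "?R(20 := v, 16 := 3 + n + p * k, 17 := 3 + n + q * k, 13 := 0)"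
    have "(step P x ^^ 5) (46, ?R(20 := v)) = (51, ?R')"
      using regs by (auto simp: run_simps fun_eq_iff)
    then have "(step P x ^^ (5 + (t + 8))) (34, R) = (51, ?R')"
      using pop t by (simp only: funpow_add o_apply)
    moreover have "letter_inv h 0 Q ?R'"
      using inv True h pq unfolding letter_inv_def head_inv_def by (simp add: mem_upd)
    moreover have "5 + (t + 8) \<le> 17"
      using t by simp
    ultimately show ?thesis
      by blast
  qed
qed

lemma letter_finish:
  assumes "letter_inv h k Q R"
  shows "\<exists>R'. (step P x ^^ 2) (51, R) = (34, R') \<and> head_inv (Suc h) Q R'"
proof -
  have "R 2 = k" "R 13 = k"
    using assms by (auto simp: letter_inv_def mem_def)
  then have "(step P x ^^ 2) (51, R) = (34, R(20 := 0))"
    by (simp add: run_simps)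
  moreover have "head_inv (Suc h) Q (R(20 := 0))"
    using assms unfolding letter_inv_def head_inv_def search_inv_def
    by (auto simp: mem_upd less_Suc_eq)
  ultimately show ?thesis
    by blast
qed

text \<open>The bound 30 is 6 for reading both successors, 11 for each \<open>push\<close>, and 2
  for the next letter.\<close>

lemma letter_step:
  assumes inv: "letter_inv h a Q R" and a: "a < k"
  shows "\<exists>Q' R' t. t \<le> 30 \<and> (step P x ^^ t) (51, R) = (51, R') \<and> letter_inv h (Suc a) Q' R'"
proof -
  define p q where "p = R 14" and "q = R 15"
  define z where "z c = (pick c s p (d p a) (d q a), d q a)" for c
  have mem: "mem Q R" and Qh: "Q ! h = (p, q)" and h: "h < length Q" and sinv: "search_inv h Q"
    using inv by (auto simp: letter_inv_def p_def q_def)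
  then have mem_pq: "(p, q) \<in> set Q"
    using nth_mem by fastforce
  have less: "p < n" "q < n"
    using mem_pq mem by (auto simp: mem_def)
  have z_less: "pick c s p (d p a) (d q a) < n" "d q a < n" for c
    using pick_in[of s "{..<n}" p "d p a" "d q a" c] start_less less succ_less a by auto
  have z_reach: "z c \<in> reachable" if "c \<in> {c1, c2}" for c
    using mem_pq sinv a that unfolding z_def search_inv_def by (intro pairs_step) auto
  let ?R = "R(20 := 3 + n + q * k + a, 18 := d p a, 19 := d q a)"
  have "R 2 = k" "R 13 = a" "R 16 = 3 + n + p * k" "R 17 = 3 + n + q * k"
    using inv mem by (auto simp: letter_inv_def mem_def p_def q_def)
  then have R0: "(step P x ^^ 6) (51, R) = (57, ?R)"
    using a less input_succ by (auto simp: run_simps fun_eq_iff)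
  have R0_mem: "mem Q ?R"
    using mem by (simp add: mem_upd)
  have reg: "reg c < 32" "reg c \<noteq> 12" "reg c \<noteq> 20" "reg c \<noteq> 21" for c
    by (cases c; simp)+
  have R_reg: "R' (reg c) = pick c s p (d p a) (d q a)"
    if "R' 4 = s" "R' 14 = p" "R' 18 = d p a" "R' 19 = d q a" for R' c
    using that by (cases c) auto
  have R0_regs: "?R 4 = s" "?R 14 = p" "?R 18 = d p a" "?R 19 = d q a"
    using mem by (auto simp: mem_def p_def)
  note R0_reg = R_reg[of ?R, OF R0_regs]
  obtain R1 t1 where R1: "t1 \<le> 11" "(step P x ^^ t1) (57, ?R) = (68, R1)" "mem (visit Q (z c1)) R1"
      "\<forall>r<32. r \<notin> {12, 20, 21} \<longrightarrow> R1 r = ?R r"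
    using push[OF code_at_push(2)[of c1 c2] R0_mem reg] unfolding R0_reg R0_regs z_def[symmetric]
    using z_less by auto
  \<comment> \<open>The first \<open>push\<close> spares the registers from which the second one
    takes its pair.\<close>
  have R1_regs: "R1 4 = s" "R1 14 = p" "R1 18 = d p a" "R1 19 = d q a"
    using R1(4) R0_regs by auto
  note R1_reg = R_reg[of R1, OF R1_regs]
  define Q' where "Q' = visit (visit Q (z c1)) (z c2)"
  obtain R2 t2 where R2: "t2 \<le> 11" "(step P x ^^ t2) (68, R1) = (79, R2)" "mem Q' R2"
      "\<forall>r<32. r \<notin> {12, 20, 21} \<longrightarrow> R2 r = R1 r"
    using push[OF code_at_push(3)[of c1 c2] R1(3) reg] unfolding R1_reg R1_regs z_def[symmetric] Q'_def
    using z_less by auto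
  let ?R' = "R2(13 := Suc a)"
  have R2_old: "R2 r = R r" if "r \<in> {11, 13, 14, 15, 16, 17}" for r
    using that R2(4) R1(4) by auto
  have "R2 (Suc 0) = 1" "R2 13 = a"
    using R2(3) R2_old[of 13] \<open>R 13 = a\<close> by (auto simp: mem_def)
  then have R': "(step P x ^^ 2) (79, R2) = (51, ?R')"
    by (simp add: run_simps)
  have "(step P x ^^ (2 + (t2 + (t1 + 6)))) (51, R) = (51, ?R')"
    using R0 R1(2) R2(2) R' by (simp only: funpow_add o_apply)
  moreover have "2 + (t2 + (t1 + 6)) \<le> 30"
    using R1 R2 by simp
  moreover have "letter_inv h (Suc a) Q' ?R'"
  proof -
    have sub: "set Q \<subseteq> set Q'" "z c1 \<in> set Q'" "z c2 \<in> set Q'"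
      by (auto simp: Q'_def set_visit)
    have len: "h < length (visit Q (z c1))" "h < length Q'"
      using h length_visit[of Q "z c1"] length_visit[of "visit Q (z c1)" "z c2"]
      by (auto simp: Q'_def)
    have nth: "Q' ! h = (p, q)"
      using h len Qh by (simp add: Q'_def nth_visit)
    have "expanded Q' (p, q) a"
      using sub by (auto simp: expanded_def z_def)
    moreover have "\<forall>b<a. expanded Q' (p, q) b" "harmless (p, q)"
      using inv Qh sub by (auto simp: letter_inv_def intro: expanded_mono)
    moreover have "search_inv h Q'"
      unfolding Q'_def using sinv z_reach by (intro search_inv_visit) auto
    moreover have "mem Q' ?R'"
      using R2(3) by (simp add: mem_upd)
    ultimately show ?thesis
      using inv a len nth unfolding letter_inv_def
      by (auto simp: R2_old p_def q_def less_Suc_eq)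
  qed
  ultimately show ?thesis
    by blast
qed

lemma letter_loop:
  "letter_inv h a Q R \<Longrightarrow> \<exists>Q' R' t. t \<le> 30 * (k - a) + 2 \<and> (step P x ^^ t) (51, R) = (34, R') \<and>
     head_inv (Suc h) Q' R'"
proof (induction "k - a" arbitrary: a Q R)
  case 0
  then have "a = k"
    by (simp add: letter_inv_def)
  then show ?case
    using letter_finish[of h Q R] 0 by (metis le_add2)
next
  case (Suc m)
  then have a: "a < k"
    by simp
  from letter_step[OF Suc.prems a] obtain Q1 R1 t1
    where R1: "t1 \<le> 30" "(step P x ^^ t1) (51, R) = (51, R1)" "letter_inv h (Suc a) Q1 R1"
    by blast
  have "m = k - Suc a"
    using Suc.hyps(2) by simp
  from Suc.hyps(1)[OF this R1(3)] obtain Q' R' t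
    where R': "t \<le> 30 * (k - Suc a) + 2" "(step P x ^^ t) (51, R1) = (34, R')" "head_inv (Suc h) Q' R'"
    by blast
  have "(step P x ^^ (t + t1)) (51, R) = (34, R')"
    using R1 R' by (simp add: funpow_add)
  moreover have "t + t1 \<le> 30 * (k - a) + 2"
    using R1 R' a by simp
  ultimately show ?case
    using R' by blast
qed

text \<open>The queue has no repetitions and consists of pairs of numbers below
  \<open>n\<close>.\<close>

lemma head_inv_le: "head_inv h Q R \<Longrightarrow> h \<le> n * n"
proof -
  assume inv: "head_inv h Q R"
  then have "card (set Q) \<le> card ({..<n} \<times> {..<n})"
    by (intro card_mono) (auto simp: head_inv_def mem_def)
  with inv show ?thesis
    by (auto simp: head_inv_def search_inv_def mem_def distinct_card)
qed

text \<open>A full pass costs at most 17 + 30 * \<open>k\<close> + 2 steps and advances the head,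
  which never exceeds \<open>n * n\<close>; the last 17 steps pay for acceptance or
  rejection.\<close>

lemma main_loop:
  "head_inv h Q R \<Longrightarrow> answers_from P x (34, R) ((n * n - h) * (30 * k + 19) + 17) answer"
proof (induction "n * n - h" arbitrary: h Q R rule: less_induct)
  case less
  have hQ: "h \<le> length Q"
    using less.prems by (simp add: head_inv_def search_inv_def)
  consider "h = length Q" | "answers_from P x (34, R) 17 answer"
    | R1 t1 where "t1 \<le> 17" "(step P x ^^ t1) (34, R) = (51, R1)" "letter_inv h 0 Q R1"
    using head_step[OF less.prems] hQ by force
  then show ?case
  proof cases
    case 1
    from head_finish[OF less.prems 1] show ?thesis
      by (rule answers_from_mono) simp
  next
    case 2
    then show ?thesis
      by (rule answers_from_mono) simp
  next
    case 3
    from letter_loop[OF 3(3)] obtain Q' R' t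
      where R': "t \<le> 30 * k + 2" "(step P x ^^ t) (51, R1) = (34, R')" "head_inv (Suc h) Q' R'"
      by auto
    have h: "Suc h \<le> n * n"
      using head_inv_le[OF R'(3)] .
    have "(step P x ^^ (t + t1)) (34, R) = (34, R')"
      using 3 R' by (simp add: funpow_add)
    moreover have "answers_from P x (34, R') ((n * n - Suc h) * (30 * k + 19) + 17) answer"
      using h by (intro less.hyps[OF _ R'(3)]) simp
    moreover have "t + t1 + ((n * n - Suc h) * (30 * k + 19) + 17) \<le> (n * n - h) * (30 * k + 19) + 17"
    proof -
      have "n * n - h = Suc (n * n - Suc h)"
        using h by simp
      then show ?thesis
        using 3(1) R'(1) by simp
    qed
    ultimately show ?thesis
      by (rule answers_from_funpow)
  qed
qed

lemma closure_program_correct: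
  "answers_within P x (n * n * (30 * k + 19) + 10 * n + 43) answer"
proof -
  from init obtain R t
    where R: "t \<le> 10 * n + 26" "(step P x ^^ t) (0, \<lambda>_. 0) = (34, R)" "mem [(s, s)] R" "R 11 = queue"
    by blast
  have "head_inv 0 [(s, s)] R"
    using R pairs.pairs_start by (simp add: head_inv_def search_inv_def)
  from answers_from_funpow[OF R(2) main_loop[OF this]] R(1) show ?thesis
    by (simp add: answers_within_iff)
qed

end


section \<open>From encoded automata to the search\<close>

lemma position_in:
  assumes "y \<in> set ys"
  shows "position ys y < length ys" "ys ! position ys y = y"
proof -
  show "position ys y < length ys"
    unfolding position_def using assms by (induction ys) auto
  then show "ys ! position ys y = y"
    unfolding position_def using nth_length_takeWhile[of "\<lambda>z. z \<noteq> y" ys] by simp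
qed

lemma position_nth: "distinct ys \<Longrightarrow> i < length ys \<Longrightarrow> position ys (ys ! i) = i"
  using position_in[of "ys ! i" ys] nth_eq_iff_index_eq by fastforce

lemma nth_concat_rows:
  "\<forall>r\<in>set rows. length r = k \<Longrightarrow> i < length rows \<Longrightarrow> j < k \<Longrightarrow> concat rows ! (i * k + j) = rows ! i ! j"
proof (induction rows arbitrary: i)
  case (Cons r rows)
  then show ?case
    by (cases i) (auto simp: nth_append add.assoc)
qed simp

lemma length_concat_rows: "\<forall>r\<in>set rows. length r = k \<Longrightarrow> length (concat rows) = length rows * k"
  by (induction rows) auto

locale encoded_dfa =
  fixes M :: "('q, 'a) dfa" and qs :: "'q list" and as :: "'a list"
  assumes dfa: "is_dfa M"
    and qs: "distinct qs" "set qs = states M"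
    and as: "distinct as" "set as = alphabet M"
begin

definition index_delta :: "nat \<Rightarrow> nat \<Rightarrow> nat" where
  "index_delta i a = position qs (delta M (qs ! i) (as ! a))"

definition index_final :: "nat set" where
  "index_final = {i. i < length qs \<and> qs ! i \<in> final M}"

abbreviation index_start :: nat where
  "index_start \<equiv> position qs (start M)"

lemma start_in: "start M \<in> set qs"
  using dfa qs by (simp add: is_dfa_def)

lemma delta_in: "q \<in> set qs \<Longrightarrow> a \<in> set as \<Longrightarrow> delta M q a \<in> set qs"
  using dfa qs as by (simp add: is_dfa_def)

lemma nth_index_delta: "i < length qs \<Longrightarrow> a < length as \<Longrightarrow> qs ! index_delta i a = delta M (qs ! i) (as ! a)"
  unfolding index_delta_def by (intro position_in delta_in) auto

lemma index_delta_less: "i < length qs \<Longrightarrow> a < length as \<Longrightarrow> index_delta i a < length qs"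
  unfolding index_delta_def by (intro position_in delta_in) auto

text \<open>The header takes three cells and the acceptance bits one per state, hence the offset
  \<open>3 + n\<close> of the transition table.\<close>

lemma search: "search (encode_dfa qs as M) (length qs) (length as) index_start index_final index_delta"
proof
  let ?rows = "map (\<lambda>q. map (\<lambda>a. position qs (delta M q a)) as) qs"
  have len: "length (concat ?rows) = length qs * length as"
    by (subst length_concat_rows[of _ "length as"]) auto
  show "input_at (encode_dfa qs as M) (3 + p) = of_bool (p \<in> index_final)" if "p < length qs" for p
    using that by (simp add: input_at_def encode_dfa_def nth_append index_final_def)
  show "input_at (encode_dfa qs as M) (3 + length qs + p * length as + a) = index_delta p a"
    if "p < length qs" "a < length as" for p a
  proof -
    have "concat ?rows ! (p * length as + a) = index_delta p a"
      using that by (subst nth_concat_rows) (auto simp: index_delta_def)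
    then show ?thesis
      using row_index_less[OF that] len
      by (simp add: input_at_def encode_dfa_def nth_append add.assoc)
  qed
qed (auto simp: input_at_def encode_dfa_def position_in start_in index_delta_less)

text \<open>Indexing into \<open>qs\<close> commutes with the transitions and, by
  \<open>pick_image\<close>, with the choices. \<open>pairs_position\<close> is the transport
  back.\<close>

lemma index_pairs_nth:
  assumes "(i, j) \<in> pairs C {..<length as} index_delta index_start"
  shows "i < length qs \<and> j < length qs \<and> (qs ! i, qs ! j) \<in> pairs C (alphabet M) (delta M) (start M)"
  using assms
proof induction
  case pairs_start
  then show ?case
    by (simp add: position_in start_in pairs.pairs_start)
next
  case (pairs_step i j a c)
  let ?i = "pick c index_start i (index_delta i a) (index_delta j a)"
  have "?i < length qs"
    using pick_in[of index_start "{..<length qs}" i "index_delta i a" "index_delta j a" c] pairs_step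
    by (auto simp: position_in start_in index_delta_less)
  moreover have "qs ! ?i = pick c (start M) (qs ! i) (delta M (qs ! i) (as ! a)) (delta M (qs ! j) (as ! a))"
    using pairs_step
    by (simp flip: pick_image[where f = "nth qs"] add: position_in start_in nth_index_delta)
  moreover have "as ! a \<in> alphabet M"
    using pairs_step by (simp flip: as(2))
  ultimately show ?case
    using pairs_step pairs.pairs_step[of "qs ! i" "qs ! j" C _ _ _ "as ! a" c]
    by (simp add: nth_index_delta index_delta_less)
qed

lemma pairs_position:
  assumes "(p, q) \<in> pairs C (alphabet M) (delta M) (start M)"
  shows "p \<in> set qs \<and> q \<in> set qs \<and>
    (position qs p, position qs q) \<in> pairs C {..<length as} index_delta index_start"
  using assms
proof induction
  case pairs_start
  then show ?case
    by (simp add: start_in pairs.pairs_start)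
next
  case (pairs_step p q a c)
  then have a: "a \<in> set as"
    by (simp add: as(2))
  have d: "index_delta (position qs r) (position as a) = position qs (delta M r a)" if "r \<in> set qs" for r
    using that a by (simp add: index_delta_def position_in)
  have "pick c (start M) p (delta M p a) (delta M q a) \<in> set qs"
    using pairs_step a by (intro pick_in) (auto simp: start_in delta_in)
  moreover have "(pick c index_start (position qs p) (position qs (delta M p a)) (position qs (delta M q a)),
      position qs (delta M q a)) \<in> pairs C {..<length as} index_delta index_start"
    using pairs_step pairs.pairs_step[of "position qs p" "position qs q" C "{..<length as}" index_delta
        index_start "position as a" c] a
    by (simp add: d position_in)
  ultimately show ?case
    using pairs_step a by (simp add: pick_image delta_in)
qed

lemma index_pairs_final_iff:
  "(\<forall>z\<in>pairs C {..<length as} index_delta index_start. snd z \<in> index_final \<longrightarrow> fst z \<in> index_final) \<longleftrightarrow>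
   (\<forall>(p, q)\<in>pairs C (alphabet M) (delta M) (start M). q \<in> final M \<longrightarrow> p \<in> final M)" (is "?I \<longleftrightarrow> ?S")
proof
  assume ?I
  show ?S
  proof clarify
    fix p q
    assume pq: "(p, q) \<in> pairs C (alphabet M) (delta M) (start M)" "q \<in> final M"
    with pairs_position[OF pq(1)] \<open>?I\<close> have "position qs p \<in> index_final"
      by (auto simp: index_final_def position_in)
    with pairs_position[OF pq(1)] show "p \<in> final M"
      by (simp add: index_final_def position_in)
  qed
next
  assume ?S
  then show ?I
    using index_pairs_nth unfolding index_final_def by fastforce
qed

lemma closure_program_decides:
  assumes "word_rule {c1, c2} R" and "\<And>v w. R v w \<Longrightarrow> set v \<subseteq> set w"
  shows "answers_within (closure_program c1 c2) (encode_dfa qs as M)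
    (length qs * length qs * (30 * length as + 19) + 10 * length qs + 43) (closed_under R (language M))"
  using search.closure_program_correct[OF search, of c1 c2] closed_under_iff_pairs[OF assms, of M]
  unfolding search.harmless_def[OF search] index_pairs_final_iff by simp

end

text \<open>The program depends only on the two choices and so serves all alphabets; the alphabet
  enters through \<open>card A\<close> in the time bound.\<close>

lemma closed_under_decidable:
  fixes R :: "'a list \<Rightarrow> 'a list \<Rightarrow> bool"
  assumes rule: "word_rule {c1, c2} R" and sub: "\<And>v w. R v w \<Longrightarrow> set v \<subseteq> set w"
  shows "dfa_decidable_in_time (\<lambda>n. real n ^ 2) (\<lambda>M :: ('q, 'a) dfa. closed_under R (language M))"
proof -
  define T where "T A n = n * n * (30 * card A + 19) + 10 * n + 43" for A :: "'a set" and n :: nat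
  have bound: "(\<lambda>n. real (T A n)) \<in> O(\<lambda>n. real n ^ 2)" for A
  proof (rule bigoI)
    \<comment> \<open>The constant 72 is 19 + 10 + 43, as both \<open>n\<close> and 1 are at most
      \<open>n * n\<close> for positive \<open>n\<close>.\<close>
    show "\<forall>\<^sub>F n in sequentially. norm (real (T A n)) \<le> real (30 * card A + 72) * norm (real n ^ 2)"
    proof (rule eventually_sequentiallyI)
      fix n :: nat
      assume "1 \<le> n"
      then have "n \<le> n * n" "1 \<le> n * n"
        by simp_all
      then have "T A n \<le> (30 * card A + 72) * n\<^sup>2"
        unfolding T_def power2_eq_square by (simp only: algebra_simps)
      then have "real (T A n) \<le> real ((30 * card A + 72) * n\<^sup>2)"
        by (rule of_nat_mono)
      then show "norm (real (T A n)) \<le> real (30 * card A + 72) * norm (real n ^ 2)"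
        by simp
    qed
  qed
  have answers: "answers_within (closure_program c1 c2) (encode_dfa qs as M) (T A (card (states M)))
      (closed_under R (language M))"
    if "is_dfa M" "alphabet M = A" "distinct qs" "set qs = states M" "distinct as" "set as = A"
    for A M as and qs :: "'q list"
  proof -
    interpret encoded_dfa M qs as
      using that by unfold_locales auto
    have "card (states M) = length qs" "card A = length as"
      using that by (metis distinct_card)+
    then show ?thesis
      using closure_program_decides[OF rule sub] by (simp add: T_def)
  qed
  have "\<exists>T. (\<lambda>n. real (T n)) \<in> O(\<lambda>n. real n ^ 2) \<and> (\<forall>(M :: ('q, 'a) dfa) qs as. is_dfa M \<longrightarrow>
      alphabet M = A \<longrightarrow> distinct qs \<longrightarrow> set qs = states M \<longrightarrow> distinct as \<longrightarrow> set as = A \<longrightarrow>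
      answers_within (closure_program c1 c2) (encode_dfa qs as M) (T (card (states M)))
        (closed_under R (language M)))" for A
    using bound answers by (intro exI[of _ "T A"]) blast
  then show ?thesis
    unfolding dfa_decidable_in_time_def by (intro exI[of _ "closure_program c1 c2"]) simp
qed

theorem theorem3:
  shows "dfa_decidable_in_time (\<lambda>n. real n ^ 2)
           (\<lambda>M :: ('q, 'a) dfa. closed_under prefix (language M)) \<and>
         dfa_decidable_in_time (\<lambda>n. real n ^ 2)
           (\<lambda>M :: ('q, 'a) dfa. closed_under suffix (language M)) \<and>
         dfa_decidable_in_time (\<lambda>n. real n ^ 2)
           (\<lambda>M :: ('q, 'a) dfa. closed_under subseq (language M))"
proof (intro conjI)
  show "dfa_decidable_in_time (\<lambda>n. real n ^ 2)
      (\<lambda>M :: ('q, 'a) dfa. closed_under prefix (language M))"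
    by (rule closed_under_decidable[OF word_rule_prefix set_mono_prefix])
  show "dfa_decidable_in_time (\<lambda>n. real n ^ 2)
      (\<lambda>M :: ('q, 'a) dfa. closed_under suffix (language M))"
    by (rule closed_under_decidable[OF word_rule_suffix set_mono_suffix])
  show "dfa_decidable_in_time (\<lambda>n. real n ^ 2)
      (\<lambda>M :: ('q, 'a) dfa. closed_under subseq (language M))"
    by (rule closed_under_decidable[OF word_rule_subseq]) (auto dest: subseq_order.trans list_emb_set)
qed

end
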